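(* Let $n\geq 1$ be an integer. Then $$\sum_{\sigma \in S_n} (-1)^{\ell(\sigma)} q^{\mathrm{omaj}(\sigma)} =\left\lfloor\tfrac{n}{2}\right\rfloor!\prod_{i=1}^{\lfloor n/2\rfloor}(1-q^{i}),$$ and $$\sum_{\sigma \in S_n} (-1)^{\ell(\sigma)} q^{\mathrm{emaj}(\sigma)} =p_{n+1}\left\lfloor\tfrac{n}{2}\right\rfloor!\prod_{i=1}^{\lfloor (n-1)/2\rfloor}(1-q^{i}).$$
   Context: $S_n$ is the group of bijections of $[n]=\{1,\dots,n\}$. For $\sigma\in S_n$: $\ell(\sigma)$ is the number of inversions, i.e. of pairs $i<j$ in $[n]$ with $\sigma(i)>\sigma(j)$; $D(\sigma)=\{i\in[n-1]:\sigma(i)>\sigma(i+1)\}$; $D(\sigma)_o$ and $D(\sigma)_e$ are the sets of odd, respectively even, elements of $D(\sigma)$; $\mathrm{omaj}(\sigma)=\sum_{i\in D(\sigma)_o}\frac{i+1}{2}$, $\mathrm{emaj}(\sigma)=\sum_{i\in D(\sigma)_e}\frac{i}{2}$. For an integer $k$, $p_k=(1+(-1)^k)/2$. Empty products equal $1$. *)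

theory Defs
  imports
    "HOL-Combinatorics.Permutations"
    "HOL-Computational_Algebra.Polynomial"
begin

text \<open>
  The symmetric group on \<open>{1..n}\<close> is \<open>{\<sigma>. \<sigma> permutes {1..n}}\<close>. Its elements are total functions
  on \<open>nat\<close> (the identity outside \<open>{1..n}\<close>), so the statistics below take \<open>n\<close> as a parameter.
\<close>

definition inversion_number :: "nat \<Rightarrow> (nat \<Rightarrow> nat) \<Rightarrow> nat" where
  "inversion_number n \<sigma> = card {(i, j). i \<in> {1..n} \<and> j \<in> {1..n} \<and> i < j \<and> \<sigma> i > \<sigma> j}"

definition descent_set :: "nat \<Rightarrow> (nat \<Rightarrow> nat) \<Rightarrow> nat set" where
  "descent_set n \<sigma> = {i \<in> {1..n - 1}. \<sigma> i > \<sigma> (i + 1)}"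

text \<open>The divisions in the next two definitions are exact.\<close>

definition omaj :: "nat \<Rightarrow> (nat \<Rightarrow> nat) \<Rightarrow> nat" where
  "omaj n \<sigma> = (\<Sum>i \<in> {i \<in> descent_set n \<sigma>. odd i}. (i + 1) div 2)"

definition emaj :: "nat \<Rightarrow> (nat \<Rightarrow> nat) \<Rightarrow> nat" where
  "emaj n \<sigma> = (\<Sum>i \<in> {i \<in> descent_set n \<sigma>. even i}. i div 2)"

definition parity_coeff :: "int \<Rightarrow> rat" where
  "parity_coeff k = (1 + (- 1) powi k) / 2"

text \<open>
  The indeterminate \<open>q\<close>. Rational coefficients are used so that \<^const>\<open>parity_coeff\<close>, which is
  always 0 or 1, can be written with a genuine division.
\<close>

abbreviation q :: "rat poly" where
  "q \<equiv> [:0, 1:]"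

end

theory Submission
  imports Defs
begin

text \<open>
  Both sums are signed sums over \<open>S\<^sub>n\<close> in which a descent at a position \<open>i\<close> of a prescribed set \<open>M\<close>
  contributes a factor \<open>x i\<close>, and \<open>M\<close> consists of the odd or of the even positions. As \<open>M\<close> contains no
  two neighbours, it cuts out disjoint blocks \<open>{i, i + 1}\<close> of positions.

  Cut the values into pairs \<open>{2j - 1, 2j}\<close>. Swapping the values \<open>2j - 1\<close> and \<open>2j\<close> in \<open>\<sigma>\<close> changes the
  parity of the number of inversions, and, because the two values are adjacent, it changes no other
  comparison between values. So if \<open>2j - 1\<close> and \<open>2j\<close> do not fill a common block, no descent in \<open>M\<close>
  changes, and \<open>\<sigma>\<close> cancels against its image. Only those \<open>\<sigma>\<close> survive that place every pair of values in
  a block (\<open>sum_signed_weight_eq_sum_paired\<close>).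

  If \<open>M\<close> is the set of odd positions, put \<open>m = \<lfloor>n/2\<rfloor>\<close>. A survivor is given by a permutation \<open>\<tau>\<close> of the
  \<open>m\<close> blocks together with the set \<open>T\<close> of blocks whose two values appear in decreasing order
  (\<open>bij_betw_block_perm\<close>). Each inversion of \<open>\<tau>\<close> gives four inversions of \<open>\<sigma>\<close> and each element of \<open>T\<close>
  gives one, so the sign is \<open>(-1)\<^bsup>|T|\<^esup>\<close> and does not depend on \<open>\<tau>\<close>. Summing over \<open>\<tau>\<close> gives the factor
  \<open>m!\<close>, and summing over \<open>T\<close> gives the product of the \<open>1 - x i\<close> (\<open>sum_signed_weight_odd\<close>).

  If \<open>M\<close> is the set of even positions and \<open>n\<close> is odd, reversing both positions and values preserves
  the number of inversions and carries \<open>M\<close> to the odd positions, which reduces this case to the one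
  above; this is why the weights \<open>x i\<close> are kept arbitrary. If \<open>n\<close> is even, position \<open>1\<close> lies in no block
  while every value belongs to a pair, so there are no survivors and the sum is \<open>0\<close>.
\<close>

(* Keeps 2 * k - 1 from being rewritten to 2 * k - Suc 0, so that rules about odd positions apply. *)
declare One_nat_def [simp del]

section \<open>Signed sums over descents in a set of positions\<close>

definition inversions :: "nat \<Rightarrow> (nat \<Rightarrow> nat) \<Rightarrow> (nat \<times> nat) set" where
  "inversions n \<sigma> = {(i, j). i \<in> {1..n} \<and> j \<in> {1..n} \<and> i < j \<and> \<sigma> i > \<sigma> j}"

lemma inversion_number_eq_card: "inversion_number n \<sigma> = card (inversions n \<sigma>)"
  by (simp add: inversion_number_def inversions_def)

lemma finite_inversions [simp]: "finite (inversions n \<sigma>)"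
  by (rule finite_subset[of _ "{1..n} \<times> {1..n}"]) (auto simp: inversions_def)

definition signed_weight :: "nat \<Rightarrow> nat set \<Rightarrow> (nat \<Rightarrow> 'a) \<Rightarrow> (nat \<Rightarrow> nat) \<Rightarrow> 'a::comm_ring_1" where
  "signed_weight n M x \<sigma> =
     (- 1) ^ inversion_number n \<sigma> * (\<Prod>i\<in>M. if \<sigma> i > \<sigma> (Suc i) then x i else 1)"

definition paired :: "nat set \<Rightarrow> (nat \<Rightarrow> nat) \<Rightarrow> nat \<Rightarrow> bool" where
  "paired M \<sigma> j \<longleftrightarrow> (\<exists>i\<in>M. {\<sigma> i, \<sigma> (Suc i)} = {2 * j - 1, 2 * j})"

section \<open>Cancellation by swapping adjacent values\<close>

text \<open>No value lies strictly between \<open>a\<close> and \<open>a + 1\<close>, so swapping them affects only the comparison of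
  these two with each other.\<close>

lemma transpose_Suc_less_iff:
  assumes "{u, v} \<noteq> {a, Suc a}"
  shows "transpose a (Suc a) u < transpose a (Suc a) v \<longleftrightarrow> u < v"
  using assms by (auto simp: transpose_def doubleton_eq_iff)

text \<open>The inversion sets before and after the swap differ in exactly one element, the pair \<open>e\<close> of the
  positions of \<open>a\<close> and \<open>a + 1\<close>.\<close>

lemma neg_one_power_inversion_number_flip:
  assumes \<sigma>: "\<sigma> permutes {1..n}" and a: "a \<in> {1..n}" "Suc a \<in> {1..n}"
  shows "(- 1) ^ inversion_number n (transpose a (Suc a) \<circ> \<sigma>)
       = - ((- 1) ^ inversion_number n \<sigma> :: 'a::comm_ring_1)"
proof -
  let ?t = "transpose a (Suc a)"
  let ?I = "inversions n \<sigma>" and ?I' = "inversions n (?t \<circ> \<sigma>)"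
  obtain p where p: "p \<in> {1..n}" "\<sigma> p = a"
    using permutes_image[OF \<sigma>] a(1) by (metis imageE)
  obtain r where r: "r \<in> {1..n}" "\<sigma> r = Suc a"
    using permutes_image[OF \<sigma>] a(2) by (metis imageE)
  define e where "e = (min p r, max p r)"
  have inj: "\<sigma> i = \<sigma> j \<longleftrightarrow> i = j" for i j
    using permutes_inj[OF \<sigma>] by (auto dest: injD)
  have pr: "p \<noteq> r" using p r by auto
  have other: "x \<in> ?I' \<longleftrightarrow> x \<in> ?I" if "x \<noteq> e" for x
  proof (cases "fst x < snd x")
    case True
    have "{\<sigma> (snd x), \<sigma> (fst x)} \<noteq> {\<sigma> p, \<sigma> r}"
      using that True by (cases x) (auto simp: doubleton_eq_iff inj e_def min_def max_def split: if_splits)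
    then show ?thesis
      using transpose_Suc_less_iff[of "\<sigma> (snd x)" "\<sigma> (fst x)" a] p r
      by (cases x) (auto simp: inversions_def)
  qed (auto simp: inversions_def)
  have e_iff: "e \<in> ?I' \<longleftrightarrow> e \<notin> ?I"
    using pr p r by (auto simp: inversions_def e_def min_def max_def)
  show ?thesis
  proof (cases "e \<in> ?I")
    case True
    then have "x \<in> ?I \<longleftrightarrow> x \<in> insert e ?I'" for x
      using other[of x] by (cases "x = e") simp_all
    then have "?I = insert e ?I'" by (rule set_eqI)
    moreover have "e \<notin> ?I'" using True e_iff by simp
    ultimately have "card ?I = Suc (card ?I')" by simp
    then show ?thesis by (simp add: inversion_number_eq_card)
  next
    case False
    then have "x \<in> ?I' \<longleftrightarrow> x \<in> insert e ?I" for x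
      using other[of x] e_iff by (cases "x = e") simp_all
    then have "?I' = insert e ?I" by (rule set_eqI)
    then have "card ?I' = Suc (card ?I)" using False by simp
    then show ?thesis by (simp add: inversion_number_eq_card)
  qed
qed

lemma signed_weight_flip:
  assumes "\<sigma> permutes {1..n}" "j \<in> {1..n div 2}" "\<not> paired M \<sigma> j"
  shows "signed_weight n M x (transpose (2 * j - 1) (2 * j) \<circ> \<sigma>) = - signed_weight n M x \<sigma>"
proof -
  define a where "a = 2 * j - 1"
  have a: "2 * j = Suc a" "a \<in> {1..n}" "Suc a \<in> {1..n}"
    using assms(2) by (auto simp: a_def)
  have "(transpose a (Suc a) \<circ> \<sigma>) i > (transpose a (Suc a) \<circ> \<sigma>) (Suc i) \<longleftrightarrow> \<sigma> i > \<sigma> (Suc i)"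
    if "i \<in> M" for i
    using assms(3) that transpose_Suc_less_iff[of "\<sigma> (Suc i)" "\<sigma> i" a]
    by (auto simp: paired_def a doubleton_eq_iff)
  then show ?thesis
    unfolding signed_weight_def a_def[symmetric] a(1)
    using neg_one_power_inversion_number_flip[OF assms(1) a(2,3), where 'a='a]
    by (simp cong: prod.cong)
qed

text \<open>A swap within a pair of values maps every pair of values onto itself. This makes the successive
  cancellations for different \<open>j\<close> compatible with each other.\<close>

lemma paired_flip:
  assumes "j \<ge> 1" "j' \<ge> 1"
  shows "paired M (transpose (2 * j - 1) (2 * j) \<circ> \<sigma>) j' \<longleftrightarrow> paired M \<sigma> j'"
proof -
  define t where "t = transpose (2 * j - 1) (2 * j)"
  have img: "t ` {2 * j' - 1, 2 * j'} = {2 * j' - 1, 2 * j'}"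
    using assms by (cases "j = j'") (auto simp: t_def transpose_def)
  have "inj t" by (simp add: t_def)
  then have "{t u, t v} = {2 * j' - 1, 2 * j'} \<longleftrightarrow> {u, v} = {2 * j' - 1, 2 * j'}" for u v
    using inj_image_eq_iff[of t "{u, v}" "{2 * j' - 1, 2 * j'}"] unfolding img by simp
  then show ?thesis by (simp add: paired_def t_def)
qed

lemma sum_eq_0_of_sign_reversing:
  fixes f :: "'b \<Rightarrow> 'a::{idom, ring_char_0}"
  assumes "\<And>s. s \<in> S \<Longrightarrow> h s \<in> S" "\<And>s. s \<in> S \<Longrightarrow> h (h s) = s" "\<And>s. s \<in> S \<Longrightarrow> f (h s) = - f s"
  shows "sum f S = 0"
proof -
  have "sum f S = (\<Sum>s\<in>S. - f s)"
    by (rule sum.reindex_bij_witness[of _ h h]) (use assms in auto)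
  also have "\<dots> = - sum f S" by (rule sum_negf)
  finally have "2 * sum f S = 0" by (metis add.right_inverse mult_2)
  then show ?thesis by simp
qed

text \<open>The conditions are imposed one pair of values at a time: among the permutations that satisfy the
  conditions for \<open>J\<close>, those that violate the condition for \<open>j\<close> cancel under the swap of \<open>2j - 1\<close> and
  \<open>2j\<close>, which keeps the conditions for \<open>J\<close> intact.\<close>

lemma sum_signed_weight_eq_sum_paired:
  fixes x :: "nat \<Rightarrow> 'a::{idom, ring_char_0}"
  shows "(\<Sum>\<sigma> | \<sigma> permutes {1..n}. signed_weight n M x \<sigma>)
       = (\<Sum>\<sigma> | \<sigma> permutes {1..n} \<and> (\<forall>j\<in>{1..n div 2}. paired M \<sigma> j). signed_weight n M x \<sigma>)"
proof -
  have "(\<Sum>\<sigma> | \<sigma> permutes {1..n}. signed_weight n M x \<sigma>)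
       = (\<Sum>\<sigma> | \<sigma> permutes {1..n} \<and> (\<forall>j\<in>J. paired M \<sigma> j). signed_weight n M x \<sigma>)"
    if "finite J" "J \<subseteq> {1..n div 2}" for J
    using that
  proof (induction J rule: finite_induct)
    case (insert j J)
    define S where "S = {\<sigma>. \<sigma> permutes {1..n} \<and> (\<forall>j\<in>J. paired M \<sigma> j)}"
    have fin: "finite S"
      by (rule finite_subset[OF _ finite_permutations[of "{1..n}"]]) (auto simp: S_def)
    have j: "j \<in> {1..n div 2}" using insert.prems by auto
    let ?h = "\<lambda>\<sigma>. transpose (2 * j - 1) (2 * j) \<circ> \<sigma>"
    have h: "?h \<sigma> \<in> {\<sigma> \<in> S. \<not> paired M \<sigma> j}" if "\<sigma> \<in> {\<sigma> \<in> S. \<not> paired M \<sigma> j}" for \<sigma>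
    proof -
      have "?h \<sigma> permutes {1..n}"
        using that j by (intro permutes_compose permutes_swap_id) (auto simp: S_def)
      moreover have "paired M (?h \<sigma>) j' \<longleftrightarrow> paired M \<sigma> j'" if "j' \<in> insert j J" for j'
        using that insert.prems by (intro paired_flip) auto
      ultimately show ?thesis using that by (auto simp: S_def)
    qed
    have "(\<Sum>\<sigma>\<in>{\<sigma> \<in> S. \<not> paired M \<sigma> j}. signed_weight n M x \<sigma>) = 0"
    proof (rule sum_eq_0_of_sign_reversing[where h = ?h])
      show "?h (?h \<sigma>) = \<sigma>" for \<sigma> by (simp add: fun_eq_iff)
      show "signed_weight n M x (?h \<sigma>) = - signed_weight n M x \<sigma>"
        if "\<sigma> \<in> {\<sigma> \<in> S. \<not> paired M \<sigma> j}" for \<sigma>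
        using that j by (intro signed_weight_flip) (auto simp: S_def)
    qed (rule h)
    moreover have "sum (signed_weight n M x) S
      = (\<Sum>\<sigma>\<in>{\<sigma> \<in> S. paired M \<sigma> j}. signed_weight n M x \<sigma>)
      + (\<Sum>\<sigma>\<in>{\<sigma> \<in> S. \<not> paired M \<sigma> j}. signed_weight n M x \<sigma>)"
      by (subst sum.union_disjoint[symmetric]) (use fin in \<open>auto intro!: sum.cong\<close>)
    moreover have "{\<sigma> \<in> S. paired M \<sigma> j}
      = {\<sigma>. \<sigma> permutes {1..n} \<and> (\<forall>j\<in>insert j J. paired M \<sigma> j)}"
      by (auto simp: S_def)
    ultimately show ?case using insert by (simp add: S_def)
  qed simp
  from this[of "{1..n div 2}"] show ?thesis by simp
qed

text \<open>In a surviving permutation a position outside all blocks cannot hold a value that belongs to a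
  pair, and the only unpaired value is \<open>n\<close> for odd \<open>n\<close>.\<close>

lemma unpaired_position:
  assumes \<sigma>: "\<sigma> permutes {1..n}" and "\<forall>j\<in>{1..n div 2}. paired M \<sigma> j"
    and "p \<in> {1..n}" "p \<notin> M" "p \<notin> Suc ` M"
  shows "odd n" "\<sigma> p = n"
proof -
  have inj: "\<sigma> i = \<sigma> j \<longleftrightarrow> i = j" for i j
    using permutes_inj[OF \<sigma>] by (auto dest: injD)
  have v: "\<sigma> p \<in> {1..n}" using permutes_in_image[OF \<sigma>] assms(3) by blast
  (* The index of the pair that would contain the value at p; it exceeds n div 2 only for the value
     n with n odd. *)
  define j where "j = (\<sigma> p + 1) div 2"
  have jv: "\<sigma> p \<in> {2 * j - 1, 2 * j}" using v unfolding j_def by (cases "even (\<sigma> p)") (auto elim!: evenE oddE)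
  have "j \<notin> {1..n div 2}"
  proof
    assume "j \<in> {1..n div 2}"
    then obtain i where "i \<in> M" "{\<sigma> i, \<sigma> (Suc i)} = {2 * j - 1, 2 * j}"
      using assms(2) unfolding paired_def by blast
    with jv have "\<sigma> p = \<sigma> i \<or> \<sigma> p = \<sigma> (Suc i)" by (metis insertE singletonD)
    with \<open>i \<in> M\<close> show False using assms(4,5) by (auto simp: inj)
  qed
  with v have "n div 2 < (\<sigma> p + 1) div 2" "\<sigma> p \<le> n" "\<sigma> p \<ge> 1" by (auto simp: j_def)
  then show "odd n" "\<sigma> p = n" by presburger+
qed

section \<open>The surviving permutations\<close>

text \<open>Positions and values are numbered alike: \<open>2k - 1\<close> and \<open>2k\<close> form block \<open>k\<close>.\<close>

definition block :: "nat \<Rightarrow> nat" where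
  "block i = (i + 1) div 2"

lemma block_odd [simp]: "k \<ge> 1 \<Longrightarrow> block (2 * k - 1) = k"
  and block_even [simp]: "block (2 * k) = k"
  by (simp_all add: block_def)

lemma block_in: "i \<in> {1..2 * m} \<Longrightarrow> block i \<in> {1..m}"
  by (auto simp: block_def)

text \<open>Block \<open>k\<close> of positions receives the values of block \<open>\<tau> k\<close>, in decreasing order exactly if \<open>k \<in> T\<close>:
  the larger value \<open>2 \<tau> k\<close> goes to the odd position if \<open>k \<in> T\<close> and to the even one otherwise.\<close>

definition block_perm :: "nat \<Rightarrow> (nat \<Rightarrow> nat) \<Rightarrow> nat set \<Rightarrow> nat \<Rightarrow> nat" where
  "block_perm m \<tau> T i = (if i \<in> {1..2 * m}
     then 2 * \<tau> (block i) - (if odd i \<longleftrightarrow> block i \<in> T then 0 else 1) else i)"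

lemma block_perm_in:
  assumes "i \<in> {1..2 * m}"
  shows "block_perm m \<tau> T i =
    2 * \<tau> (block i) - (if odd i \<longleftrightarrow> block i \<in> T then 0 else 1)"
  using assms by (simp only: block_perm_def if_True)

lemma block_perm_odd:
  "k \<in> {1..m} \<Longrightarrow> block_perm m \<tau> T (2 * k - 1) = (if k \<in> T then 2 * \<tau> k else 2 * \<tau> k - 1)"
proof -
  assume "k \<in> {1..m}"
  then have "2 * k - 1 \<in> {1..2 * m}" "odd (2 * k - 1)" "block (2 * k - 1) = k" by auto
  then show ?thesis by (simp only: block_perm_def if_True simp_thms) simp
qed

lemma block_perm_even:
  "k \<in> {1..m} \<Longrightarrow> block_perm m \<tau> T (2 * k) = (if k \<in> T then 2 * \<tau> k - 1 else 2 * \<tau> k)"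
proof -
  assume "k \<in> {1..m}"
  then have "2 * k \<in> {1..2 * m}" "even (2 * k)" "block (2 * k) = k" by auto
  then show ?thesis by (simp only: block_perm_def if_True simp_thms) simp
qed

lemma position_cases:
  fixes i m :: nat
  assumes "i \<in> {1..2 * m}"
  obtains k where "k \<in> {1..m}" "i = 2 * k - 1" | k where "k \<in> {1..m}" "i = 2 * k"
proof (cases "even i")
  case True
  with assms show ?thesis using that(2)[of "i div 2"] by auto
next
  case False
  with assms show ?thesis using that(1)[of "(i + 1) div 2"] by (auto elim!: oddE)
qed

lemma block_perm_permutes:
  assumes \<tau>: "\<tau> permutes {1..m}"
  shows "block_perm m \<tau> T permutes {1..2 * m}"
proof (rule bij_imp_permutes)
  have \<tau>in: "\<tau> k \<ge> 1 \<and> \<tau> k \<le> m" if "k \<in> {1..m}" for k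
    using permutes_in_image[OF \<tau>, of k] that by auto
  have \<tau>inj: "\<tau> k = \<tau> l \<longleftrightarrow> k = l" for k l
    using permutes_inj[OF \<tau>] by (auto dest: injD)
  have sub: "block_perm m \<tau> T ` {1..2 * m} \<subseteq> {1..2 * m}"
  proof clarify
    fix i assume "i \<in> {1..2 * m}"
    then show "block_perm m \<tau> T i \<in> {1..2 * m}"
    proof (cases rule: position_cases)
      case (1 k) with \<tau>in[of k] show ?thesis unfolding 1(2) block_perm_odd[OF 1(1)] by auto
    next
      case (2 k) with \<tau>in[of k] show ?thesis unfolding 2(2) block_perm_even[OF 2(1)] by auto
    qed
  qed
  have "inj_on (block_perm m \<tau> T) {1..2 * m}"
  proof (rule inj_onI)
    fix i i' assume i: "i \<in> {1..2 * m}" and i': "i' \<in> {1..2 * m}"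
      and eq: "block_perm m \<tau> T i = block_perm m \<tau> T i'"
    define k k' where "k = block i" and "k' = block i'"
    have k: "k \<in> {1..m}" "k' \<in> {1..m}" using block_in[OF i] block_in[OF i'] by (simp_all add: k_def k'_def)
    have eq': "2 * \<tau> k - (if odd i \<longleftrightarrow> k \<in> T then 0 else 1)
        = 2 * \<tau> k' - (if odd i' \<longleftrightarrow> k' \<in> T then 0 else 1)"
      using eq unfolding block_perm_in[OF i] block_perm_in[OF i'] k_def k'_def .
    then have "\<tau> k = \<tau> k'"
      using \<tau>in[OF k(1)] \<tau>in[OF k(2)] by (simp split: if_splits)
    then have kk: "k = k'" by (simp add: \<tau>inj)
    then have "odd i \<longleftrightarrow> odd i'" using eq' \<tau>in[OF k(1)] by (auto split: if_splits)
    with kk show "i = i'" unfolding k_def k'_def block_def by presburger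
  qed
  with sub show "bij_betw (block_perm m \<tau> T) {1..2 * m} {1..2 * m}"
    by (simp add: bij_betw_def endo_inj_surj)
qed (auto simp: block_perm_def)

lemma inversions_permutes_smaller:
  assumes "\<sigma> permutes {1..r}" "r \<le> n"
  shows "inversions n \<sigma> = inversions r \<sigma>"
proof -
  have "\<sigma> i \<le> r" if "i \<in> {1..r}" for i
    using permutes_in_image[OF assms(1), of i] that by auto
  moreover have "\<sigma> i = i" if "i \<notin> {1..r}" for i
    using permutes_not_in[OF assms(1) that] .
  ultimately have "j \<le> r" if "i \<in> {1..n}" "j \<in> {1..n}" "i < j" "\<sigma> i > \<sigma> j" for i j
    using that by (metis atLeastAtMost_iff le_less_trans less_asym not_le order_less_imp_le)
  then show ?thesis using assms(2) by (fastforce simp: inversions_def)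
qed

text \<open>Two different blocks are compared as wholes, so an inversion \<open>(k, l)\<close> of \<open>\<tau>\<close> produces the four
  inversions \<open>(2k - a, 2l - b)\<close> with \<open>a, b \<in> {0, 1}\<close>; the remaining inversions lie inside the blocks in
  \<open>T\<close>.\<close>

lemma inversion_number_block_perm:
  assumes \<tau>: "\<tau> permutes {1..m}" and T: "T \<subseteq> {1..m}" and "2 * m \<le> n"
  shows "inversion_number n (block_perm m \<tau> T) = 4 * inversion_number m \<tau> + card T"
proof -
  let ?\<sigma> = "block_perm m \<tau> T"
  have \<tau>in: "\<tau> k \<ge> 1 \<and> \<tau> k \<le> m" if "k \<in> {1..m}" for k
    using permutes_in_image[OF \<tau>, of k] that by auto
  have \<tau>inj: "\<tau> k = \<tau> l \<longleftrightarrow> k = l" for k l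
    using permutes_inj[OF \<tau>] by (auto dest: injD)
  let ?g = "\<lambda>((k, l), (a, b)). (2 * k - a, 2 * l - b)"
  let ?A = "inversions m \<tau> \<times> ({0, 1::nat} \<times> {0, 1::nat})"
  let ?B = "(\<lambda>k. (2 * k - 1, 2 * k)) ` T"
  have val: "2 * \<tau> (block i) - 1 \<le> ?\<sigma> i \<and> ?\<sigma> i \<le> 2 * \<tau> (block i)"
    if "i \<in> {1..2 * m}" for i unfolding block_perm_in[OF that] by simp
  have cross: "?\<sigma> i > ?\<sigma> j \<longleftrightarrow> \<tau> (block i) > \<tau> (block j)"
    if "i \<in> {1..2 * m}" "j \<in> {1..2 * m}" "block i \<noteq> block j" for i j
  proof -
    have "\<tau> (block i) \<noteq> \<tau> (block j)" using that(3) by (simp add: \<tau>inj)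
    moreover have "\<tau> (block i) \<ge> 1" "\<tau> (block j) \<ge> 1" using \<tau>in block_in that by blast+
    ultimately show ?thesis using val[OF that(1)] val[OF that(2)] by linarith
  qed
  have "inversions (2 * m) ?\<sigma> = ?g ` ?A \<union> ?B"
  proof (intro equalityI subsetI)
    fix z assume z: "z \<in> inversions (2 * m) ?\<sigma>"
    obtain i j where ij: "z = (i, j)" by (cases z)
    (* An inversion lies inside one block, or it comes from an inversion of \<tau>. *)
    define k l where "k = block i" and "l = block j"
    have zz: "i \<in> {1..2 * m}" "j \<in> {1..2 * m}" "i < j" "?\<sigma> i > ?\<sigma> j"
      using z by (auto simp: ij inversions_def)
    have kl: "k \<in> {1..m}" "l \<in> {1..m}" using zz block_in by (simp_all only: k_def l_def)
    show "z \<in> ?g ` ?A \<union> ?B"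
    proof (cases "k = l")
      case True
      have "2 * k \<le> i + 1" "i \<le> 2 * k" "2 * l \<le> j + 1" "j \<le> 2 * l"
        unfolding k_def l_def block_def by linarith+
      with zz(3) True have i: "i = 2 * k - 1" "j = 2 * k" by linarith+
      have "k \<in> T" using zz(4) unfolding i block_perm_odd[OF kl(1)] block_perm_even[OF kl(1)]
        by (auto split: if_splits)
      then show ?thesis by (auto simp: ij i)
    next
      case False
      then have "(k, l) \<in> inversions m \<tau>"
        using cross[of i j] zz kl div_le_mono[of "i + 1" "j + 1" 2]
        by (auto simp: inversions_def k_def l_def block_def)
      moreover have "i = 2 * k - (2 * k - i)" "2 * k - i \<in> {0, 1}"
        unfolding k_def block_def using zz(1) by auto
      moreover have "j = 2 * l - (2 * l - j)" "2 * l - j \<in> {0, 1}"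
        unfolding l_def block_def using zz(2) by auto
      ultimately have "((k, l), (2 * k - i, 2 * l - j)) \<in> ?A"
        and "z = ?g ((k, l), (2 * k - i, 2 * l - j))"
        by (auto simp: ij)
      then show ?thesis by (metis (no_types, lifting) UnI1 image_eqI)
    qed
  next
    fix z assume "z \<in> ?g ` ?A \<union> ?B"
    then show "z \<in> inversions (2 * m) ?\<sigma>"
    proof
      assume "z \<in> ?g ` ?A"
      then obtain k l a b where z: "(k, l) \<in> inversions m \<tau>" "a \<in> {0, 1::nat}" "b \<in> {0, 1::nat}"
        "z = (2 * k - a, 2 * l - b)" by auto
      then have kl: "k \<in> {1..m}" "l \<in> {1..m}" "k < l" "\<tau> k > \<tau> l" by (auto simp: inversions_def)
      have d: "block (2 * k - a) = k" "block (2 * l - b) = l" using z(2,3) kl by (auto simp: block_def)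
      have "2 * k - a \<in> {1..2 * m}" "2 * l - b \<in> {1..2 * m}" "2 * k - a < 2 * l - b"
        using z(2,3) kl by auto
      then show ?thesis using cross[of "2 * k - a" "2 * l - b"] kl unfolding d z(4)
        by (auto simp: inversions_def)
    next
      assume "z \<in> ?B"
      then obtain k where k: "k \<in> T" "z = (2 * k - 1, 2 * k)" by auto
      then have "k \<in> {1..m}" using T by auto
      then have "?\<sigma> (2 * k - 1) > ?\<sigma> (2 * k)" "2 * k - 1 \<in> {1..2 * m}" "2 * k \<in> {1..2 * m}"
        using k \<tau>in[of k] by (auto simp: block_perm_odd block_perm_even)
      then show ?thesis using k by (auto simp: inversions_def)
    qed
  qed
  moreover have "?g ` ?A \<inter> ?B = {}"
    by (auto simp: inversions_def; presburger)
  moreover have "inj_on ?g ?A"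
    by (rule inj_on_inverseI[where g = "\<lambda>(i, j). ((block i, block j), (2 * block i - i, 2 * block j - j))"])
       (auto simp: inversions_def)
  then have "card (?g ` ?A) = 4 * card (inversions m \<tau>)"
    by (simp add: card_image card_cartesian_product)
  moreover have "card ?B = card T" by (rule card_image) (auto simp: inj_on_def)
  moreover have "finite T" using T finite_subset by blast
  ultimately have "card (inversions (2 * m) ?\<sigma>) = 4 * card (inversions m \<tau>) + card T"
    by (simp add: card_Un_disjoint)
  then show ?thesis
    using inversions_permutes_smaller[OF block_perm_permutes[OF \<tau>] assms(3)]
    by (simp add: inversion_number_eq_card)
qed

lemma signed_weight_block_perm:
  assumes \<tau>: "\<tau> permutes {1..m}" and T: "T \<subseteq> {1..m}" and "2 * m \<le> n"
  shows "signed_weight n ((\<lambda>k. 2 * k - 1) ` {1..m}) x (block_perm m \<tau> T)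
       = (\<Prod>k\<in>T. - x (2 * k - 1))"
proof -
  let ?\<sigma> = "block_perm m \<tau> T"
  have \<tau>in: "\<tau> k \<ge> 1" if "k \<in> {1..m}" for k
    using permutes_in_image[OF \<tau>, of k] that by auto
  have inj: "inj_on (\<lambda>k. 2 * k - 1) {1..m}" by (auto simp: inj_on_def)
  have desc: "?\<sigma> (2 * k - 1) > ?\<sigma> (Suc (2 * k - 1)) \<longleftrightarrow> k \<in> T" if "k \<in> {1..m}" for k
  proof -
    have "Suc (2 * k - 1) = 2 * k" using that by auto
    then show ?thesis using that \<tau>in[OF that] by (auto simp: block_perm_odd block_perm_even)
  qed
  have "(\<Prod>i\<in>(\<lambda>k. 2 * k - 1) ` {1..m}. if ?\<sigma> i > ?\<sigma> (Suc i) then x i else 1)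
      = (\<Prod>k\<in>{1..m}. if k \<in> T then x (2 * k - 1) else 1)"
    unfolding prod.reindex[OF inj] comp_def by (rule prod.cong[OF refl]) (simp only: desc)
  also have "\<dots> = (\<Prod>k\<in>T. x (2 * k - 1))"
    using T by (simp add: prod.inter_restrict[symmetric] Int_absorb1)
  finally show ?thesis
    by (simp add: signed_weight_def inversion_number_block_perm[OF assms] power_add power_mult prod_uminus)
qed

text \<open>From a surviving \<open>\<sigma>\<close> one reads off \<open>\<tau> k\<close> as the index of the pair of values in block \<open>k\<close>, and \<open>T\<close> as
  the set of blocks with a descent. Every pair of values occurs in some block, so \<open>\<tau>\<close> is surjective on a
  finite set, hence a permutation. For odd \<open>n\<close> the position \<open>n\<close> lies in no block and is therefore
  fixed.\<close>

lemma bij_betw_block_perm: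
  fixes n :: nat
  defines "m \<equiv> n div 2"
  defines "M \<equiv> (\<lambda>k. 2 * k - 1) ` {1..m}"
  shows "bij_betw (\<lambda>(\<tau>, T). block_perm m \<tau> T) ({\<tau>. \<tau> permutes {1..m}} \<times> Pow {1..m})
     {\<sigma>. \<sigma> permutes {1..n} \<and> (\<forall>j\<in>{1..m}. paired M \<sigma> j)}"
proof -
  (* The inverse map. The even position 2 * k holds either value of its pair, and both have the same
     block index. *)
  define R where "R \<sigma> = ((\<lambda>k. if k \<in> {1..m} then (\<sigma> (2 * k) + 1) div 2 else k),
    {k \<in> {1..m}. \<sigma> (2 * k - 1) > \<sigma> (2 * k)})" for \<sigma> :: "nat \<Rightarrow> nat"
  have mn: "2 * m \<le> n" by (simp add: m_def)
  show ?thesis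
  proof (rule bij_betw_byWitness[where f' = R])
    show "\<forall>p\<in>{\<tau>. \<tau> permutes {1..m}} \<times> Pow {1..m}. R ((\<lambda>(\<tau>, T). block_perm m \<tau> T) p) = p"
    proof safe
      fix \<tau> :: "nat \<Rightarrow> nat" and T assume \<tau>: "\<tau> permutes {1..m}" and T: "T \<subseteq> {1..m}"
      have \<tau>in: "\<tau> k \<ge> 1" if "k \<in> {1..m}" for k
        using permutes_in_image[OF \<tau>, of k] that by auto
      have "(block_perm m \<tau> T (2 * k) + 1) div 2 = \<tau> k" if "k \<in> {1..m}" for k
        using \<tau>in[OF that] by (auto simp: block_perm_even[OF that])
      moreover have "block_perm m \<tau> T (2 * k - 1) > block_perm m \<tau> T (2 * k) \<longleftrightarrow> k \<in> T"
        if "k \<in> {1..m}" for k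
        using \<tau>in[OF that] by (auto simp: block_perm_even[OF that] block_perm_odd[OF that])
      ultimately show "R (block_perm m \<tau> T) = (\<tau>, T)"
        using T permutes_not_in[OF \<tau>] by (auto simp: R_def fun_eq_iff)
    qed
  next
    show "(\<lambda>(\<tau>, T). block_perm m \<tau> T) ` ({\<tau>. \<tau> permutes {1..m}} \<times> Pow {1..m})
      \<subseteq> {\<sigma>. \<sigma> permutes {1..n} \<and> (\<forall>j\<in>{1..m}. paired M \<sigma> j)}"
    proof clarify
      fix \<tau> :: "nat \<Rightarrow> nat" and T assume \<tau>: "\<tau> permutes {1..m}" and T: "T \<subseteq> {1..m}"
      have "block_perm m \<tau> T permutes {1..n}"
        by (rule permutes_subset[OF block_perm_permutes[OF \<tau>]]) (use mn in auto)
      moreover have "paired M (block_perm m \<tau> T) j" if "j \<in> {1..m}" for j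
      proof -
        obtain k where k: "k \<in> {1..m}" "\<tau> k = j"
          using permutes_image[OF \<tau>] \<open>j \<in> {1..m}\<close> by (metis imageE)
        have "Suc (2 * k - 1) = 2 * k" using k by auto
        then have "{block_perm m \<tau> T (2 * k - 1), block_perm m \<tau> T (Suc (2 * k - 1))} = {2 * j - 1, 2 * j}"
          by (auto simp: block_perm_even[OF k(1)] block_perm_odd[OF k(1)] k(2))
        then show ?thesis using k(1) unfolding paired_def M_def by blast
      qed
      ultimately show "block_perm m \<tau> T permutes {1..n} \<and> (\<forall>j\<in>{1..m}. paired M (block_perm m \<tau> T) j)"
        by blast
    qed
  next
    have main: "fst (R \<sigma>) permutes {1..m} \<and> block_perm m (fst (R \<sigma>)) (snd (R \<sigma>)) = \<sigma>"
      if \<sigma>: "\<sigma> permutes {1..n}" and pd: "\<forall>j\<in>{1..m}. paired M \<sigma> j" for \<sigma>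
    proof -
      have inj: "\<sigma> i = \<sigma> j \<longleftrightarrow> i = j" for i j
        using permutes_inj[OF \<sigma>] by (auto dest: injD)
      define \<tau> where "\<tau> = fst (R \<sigma>)"
      have \<tau>eq: "\<tau> k = (\<sigma> (2 * k) + 1) div 2" if "k \<in> {1..m}" for k
        using that by (simp add: \<tau>_def R_def)
      have fixn: "\<sigma> i = i" if "i \<notin> {1..2 * m}" for i
      proof (cases "i \<in> {1..n}")
        case True
        then have i: "i = n" "odd n" using that unfolding m_def by auto
        have "i \<notin> M" "i \<notin> Suc ` M" using that by (auto simp: M_def)
        then show ?thesis using unpaired_position(2)[OF \<sigma> _ True, of M] pd i by (simp add: m_def)
      qed (rule permutes_not_in[OF \<sigma>])
      have surj: "\<exists>k\<in>{1..m}. {\<sigma> (2 * k - 1), \<sigma> (2 * k)} = {2 * j - 1, 2 * j}" if j: "j \<in> {1..m}" for j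
      proof -
        obtain k where "k \<in> {1..m}" "{\<sigma> (2 * k - 1), \<sigma> (Suc (2 * k - 1))} = {2 * j - 1, 2 * j}"
          using pd j unfolding paired_def M_def by blast
        moreover from this have "Suc (2 * k - 1) = 2 * k" by auto
        ultimately show ?thesis by metis
      qed
      have "j \<in> \<tau> ` {1..m}" if j: "j \<in> {1..m}" for j
      proof -
        obtain k where k: "k \<in> {1..m}" "{\<sigma> (2 * k - 1), \<sigma> (2 * k)} = {2 * j - 1, 2 * j}"
          using surj[OF j] by blast
        then have "\<tau> k = j" using j unfolding \<tau>eq[OF k(1)] by (auto simp: doubleton_eq_iff)
        then show ?thesis using k by auto
      qed
      then have sub: "{1..m} \<subseteq> \<tau> ` {1..m}" by blast
      have card: "card (\<tau> ` {1..m}) \<le> card {1..m}" by (rule card_image_le) simp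
      have img: "\<tau> ` {1..m} = {1..m}"
        using card_seteq[OF _ sub card] by simp
      have \<tau>p: "\<tau> permutes {1..m}"
      proof (rule bij_imp_permutes)
        show "bij_betw \<tau> {1..m} {1..m}"
          unfolding bij_betw_def using img by (simp add: eq_card_imp_inj_on)
      qed (auto simp: \<tau>_def R_def)
      have pair: "{\<sigma> (2 * k - 1), \<sigma> (2 * k)} = {2 * \<tau> k - 1, 2 * \<tau> k}" if k: "k \<in> {1..m}" for k
      proof -
        have j: "\<tau> k \<in> {1..m}" using img k by blast
        obtain k' where k': "k' \<in> {1..m}" "{\<sigma> (2 * k' - 1), \<sigma> (2 * k')} = {2 * \<tau> k - 1, 2 * \<tau> k}"
          using surj[OF j] by blast
        then have "\<tau> k' = \<tau> k" using j unfolding \<tau>eq[OF k'(1)] by (auto simp: doubleton_eq_iff)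
        then have "k' = k" using permutes_inj[OF \<tau>p] by (auto dest: injD)
        then show ?thesis using k' by simp
      qed
      have "block_perm m \<tau> (snd (R \<sigma>)) i = \<sigma> i" for i
      proof (cases "i \<in> {1..2 * m}")
        case False
        then show ?thesis using fixn[OF False] by (auto simp: block_perm_def)
      next
        case True
        then show ?thesis
        proof (cases rule: position_cases)
          case (1 k)
          then show ?thesis using pair[OF 1(1)] 1(1) unfolding 1(2) block_perm_odd[OF 1(1)]
            by (auto simp: R_def doubleton_eq_iff)
        next
          case (2 k)
          then show ?thesis using pair[OF 2(1)] 2(1) unfolding 2(2) block_perm_even[OF 2(1)]
            by (auto simp: R_def doubleton_eq_iff)
        qed
      qed
      with \<tau>p show ?thesis by (auto simp: \<tau>_def)
    qed
    show "\<forall>\<sigma>\<in>{\<sigma>. \<sigma> permutes {1..n} \<and> (\<forall>j\<in>{1..m}. paired M \<sigma> j)}.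
        (\<lambda>(\<tau>, T). block_perm m \<tau> T) (R \<sigma>) = \<sigma>"
      using main by (auto simp: case_prod_beta)
    show "R ` {\<sigma>. \<sigma> permutes {1..n} \<and> (\<forall>j\<in>{1..m}. paired M \<sigma> j)}
        \<subseteq> {\<tau>. \<tau> permutes {1..m}} \<times> Pow {1..m}"
    proof (rule image_subsetI)
      fix \<sigma> assume "\<sigma> \<in> {\<sigma>. \<sigma> permutes {1..n} \<and> (\<forall>j\<in>{1..m}. paired M \<sigma> j)}"
      then have "fst (R \<sigma>) permutes {1..m}" using main by blast
      moreover have "snd (R \<sigma>) \<subseteq> {1..m}" by (auto simp: R_def)
      ultimately show "R \<sigma> \<in> {\<tau>. \<tau> permutes {1..m}} \<times> Pow {1..m}"
        by (simp add: mem_Times_iff)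
    qed
  qed
qed

text \<open>The sum over \<open>T\<close> is the expansion of the product on the right.\<close>

lemma sum_signed_weight_odd:
  fixes x :: "nat \<Rightarrow> 'a::{idom, ring_char_0}"
  shows "(\<Sum>\<sigma> | \<sigma> permutes {1..n}. signed_weight n ((\<lambda>k. 2 * k - 1) ` {1..n div 2}) x \<sigma>)
       = fact (n div 2) * (\<Prod>k = 1..n div 2. 1 - x (2 * k - 1))"
proof -
  define m where "m = n div 2"
  let ?M = "(\<lambda>k. 2 * k - 1) ` {1..m}"
  have mn: "2 * m \<le> n" by (simp add: m_def)
  have "(\<Sum>\<sigma> | \<sigma> permutes {1..n}. signed_weight n ?M x \<sigma>)
      = (\<Sum>\<sigma> | \<sigma> permutes {1..n} \<and> (\<forall>j\<in>{1..m}. paired ?M \<sigma> j). signed_weight n ?M x \<sigma>)"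
    unfolding m_def by (rule sum_signed_weight_eq_sum_paired)
  also have "\<dots> = (\<Sum>(\<tau>, T)\<in>{\<tau>. \<tau> permutes {1..m}} \<times> Pow {1..m}. signed_weight n ?M x (block_perm m \<tau> T))"
    unfolding m_def sum.reindex_bij_betw[OF bij_betw_block_perm, symmetric]
    by (simp add: case_prod_beta)
  also have "\<dots> = (\<Sum>(\<tau>, T)\<in>{\<tau>. \<tau> permutes {1..m}} \<times> Pow {1..m}. \<Prod>k\<in>T. - x (2 * k - 1))"
    by (rule sum.cong) (auto simp: signed_weight_block_perm mn)
  also have "\<dots> = fact m * (\<Sum>T\<in>Pow {1..m}. \<Prod>k\<in>T. - x (2 * k - 1))"
    by (simp add: sum.cartesian_product[symmetric] card_permutations)
  also have "(\<Sum>T\<in>Pow {1..m}. \<Prod>k\<in>T. - x (2 * k - 1)) = (\<Prod>k = 1..m. 1 - x (2 * k - 1))"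
    using prod_add[of "{1..m}" "\<lambda>k. - x (2 * k - 1)" "\<lambda>_. 1"] by (simp add: add.commute)
  finally show ?thesis by (simp add: m_def)
qed

section \<open>Even positions\<close>

text \<open>Conjugation with the order-reversing permutation of \<open>{1..n}\<close>, extended by the identity so that it
  acts on functions that permute \<open>{1..n}\<close>.\<close>

definition reverse_complement :: "nat \<Rightarrow> (nat \<Rightarrow> nat) \<Rightarrow> nat \<Rightarrow> nat" where
  "reverse_complement n \<sigma> i = (if i \<in> {1..n} then Suc n - \<sigma> (Suc n - i) else i)"

lemma reverse_complement_permutes:
  assumes \<sigma>: "\<sigma> permutes {1..n}"
  shows "reverse_complement n \<sigma> permutes {1..n}"
proof (rule bij_imp_permutes)
  have bij: "bij_betw (\<lambda>i. Suc n - i) {1..n} {1..n}"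
    by (rule bij_betw_byWitness[where f' = "\<lambda>i. Suc n - i"]) auto
  have "bij_betw ((\<lambda>i. Suc n - i) \<circ> \<sigma> \<circ> (\<lambda>i. Suc n - i)) {1..n} {1..n}"
    by (intro bij_betw_trans[OF bij] bij_betw_trans[OF permutes_imp_bij[OF \<sigma>] bij, unfolded comp_assoc])
  then show "bij_betw (reverse_complement n \<sigma>) {1..n} {1..n}"
    by (rule bij_betw_cong[THEN iffD1, rotated]) (auto simp: reverse_complement_def)
qed (auto simp: reverse_complement_def)

lemma reverse_complement_involution:
  assumes \<sigma>: "\<sigma> permutes {1..n}"
  shows "reverse_complement n (reverse_complement n \<sigma>) = \<sigma>"
proof
  fix i
  show "reverse_complement n (reverse_complement n \<sigma>) i = \<sigma> i"
    using permutes_in_image[OF \<sigma>, of i] permutes_not_in[OF \<sigma>, of i]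
    by (auto simp: reverse_complement_def)
qed

text \<open>Reversing positions swaps the two arguments and reversing values swaps them back, so a descent at
  \<open>i\<close> becomes a descent at \<open>n - i\<close>.\<close>

lemma reverse_complement_less_iff:
  assumes \<sigma>: "\<sigma> permutes {1..n}" and "i \<in> {1..n}" "j \<in> {1..n}"
  shows "reverse_complement n \<sigma> i > reverse_complement n \<sigma> j \<longleftrightarrow> \<sigma> (Suc n - j) > \<sigma> (Suc n - i)"
proof -
  have "\<sigma> (Suc n - i) \<in> {1..n}" "\<sigma> (Suc n - j) \<in> {1..n}"
    using assms by (subst permutes_in_image[OF \<sigma>]; auto)+
  moreover have "Suc n - u < Suc n - v \<longleftrightarrow> v < u" if "u \<in> {1..n}" "v \<in> {1..n}" for u v
    using that by auto
  ultimately show ?thesis using assms by (simp add: reverse_complement_def)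
qed

lemma inversion_number_reverse_complement:
  assumes \<sigma>: "\<sigma> permutes {1..n}"
  shows "inversion_number n (reverse_complement n \<sigma>) = inversion_number n \<sigma>"
proof -
  have less: "reverse_complement n \<sigma> (Suc n - i) < reverse_complement n \<sigma> (Suc n - j) \<longleftrightarrow> \<sigma> j < \<sigma> i"
    if "i \<in> {1..n}" "j \<in> {1..n}" for i j
  proof -
    have "Suc n - i \<in> {1..n}" "Suc n - j \<in> {1..n}" "Suc n - (Suc n - i) = i" "Suc n - (Suc n - j) = j"
      using that by auto
    then show ?thesis using reverse_complement_less_iff[OF \<sigma>, of "Suc n - j" "Suc n - i"] by simp
  qed
  have "bij_betw (\<lambda>(i, j). (Suc n - j, Suc n - i)) (inversions n (reverse_complement n \<sigma>)) (inversions n \<sigma>)"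
    by (rule bij_betw_byWitness[where f' = "\<lambda>(i, j). (Suc n - j, Suc n - i)"])
       (auto simp: inversions_def less reverse_complement_less_iff[OF \<sigma>])
  then show ?thesis by (simp add: inversion_number_eq_card bij_betw_same_card)
qed

text \<open>For odd \<open>n\<close> the map \<open>i \<mapsto> n - i\<close> exchanges even and odd positions, so the reverse complement
  turns this into the sum over odd positions with the weights in the opposite order.\<close>

lemma sum_signed_weight_even:
  fixes x :: "nat \<Rightarrow> 'a::{idom, ring_char_0}"
  assumes "n = 2 * m + 1"
  shows "(\<Sum>\<sigma> | \<sigma> permutes {1..n}. signed_weight n ((\<lambda>k. 2 * k) ` {1..m}) x \<sigma>)
       = fact m * (\<Prod>k = 1..m. 1 - x (2 * k))"
proof -
  let ?M = "(\<lambda>k. 2 * k - 1) ` {1..m}" and ?E = "(\<lambda>k. 2 * k) ` {1..m}"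
  (* A descent at i of the reverse complement corresponds to a descent of \<sigma> at n - i. *)
  let ?y = "\<lambda>i. x (n - i)"
  have weight: "signed_weight n ?M ?y (reverse_complement n \<sigma>) = signed_weight n ?E x \<sigma>"
    if \<sigma>: "\<sigma> permutes {1..n}" for \<sigma>
  proof -
    have 1: "n - i \<in> ?E" if "i \<in> ?M" for i
    proof -
      from that obtain k where k: "k \<in> {1..m}" "i = 2 * k - 1" by auto
      then have "n - i = 2 * (Suc m - k)" "Suc m - k \<in> {1..m}" using assms by auto
      then show ?thesis by blast
    qed
    have 2: "n - i \<in> ?M" if "i \<in> ?E" for i
    proof -
      from that obtain k where k: "k \<in> {1..m}" "i = 2 * k" by auto
      then have "n - i = 2 * (Suc m - k) - 1" "Suc m - k \<in> {1..m}" using assms by auto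
      then show ?thesis by blast
    qed
    have "(\<Prod>i\<in>?M. if reverse_complement n \<sigma> i > reverse_complement n \<sigma> (Suc i) then ?y i else 1)
        = (\<Prod>i\<in>?E. if \<sigma> i > \<sigma> (Suc i) then x i else 1)"
    proof (rule prod.reindex_bij_witness[of _ "\<lambda>i. n - i" "\<lambda>i. n - i"])
      fix i assume i: "i \<in> ?M"
      then have "i \<in> {1..n}" "Suc i \<in> {1..n}" "Suc n - i = Suc (n - i)" using assms by auto
      then show "(if \<sigma> (n - i) > \<sigma> (Suc (n - i)) then x (n - i) else 1)
          = (if reverse_complement n \<sigma> i > reverse_complement n \<sigma> (Suc i) then ?y i else 1)"
        using reverse_complement_less_iff[OF \<sigma>, of i "Suc i"] by simp
    qed (use assms 1 2 in auto)
    then show ?thesis by (simp add: signed_weight_def inversion_number_reverse_complement[OF \<sigma>])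
  qed
  have "(\<Sum>\<sigma> | \<sigma> permutes {1..n}. signed_weight n ?E x \<sigma>)
      = (\<Sum>\<sigma> | \<sigma> permutes {1..n}. signed_weight n ?M ?y \<sigma>)"
    by (rule sum.reindex_bij_witness[of _ "reverse_complement n" "reverse_complement n"])
       (auto simp: reverse_complement_involution reverse_complement_permutes weight)
  also have "\<dots> = fact m * (\<Prod>k = 1..m. 1 - ?y (2 * k - 1))"
    using sum_signed_weight_odd[of n ?y] assms by simp
  also have "(\<Prod>k = 1..m. 1 - ?y (2 * k - 1)) = (\<Prod>k = 1..m. 1 - x (2 * k))"
  proof (rule prod.reindex_bij_witness[of _ "\<lambda>k. Suc m - k" "\<lambda>k. Suc m - k"])
    fix k assume "k \<in> {1..m}"
    then have "2 * (Suc m - k) = n - (2 * k - 1)" using assms by auto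
    then show "1 - x (2 * (Suc m - k)) = 1 - ?y (2 * k - 1)" by simp
  qed auto
  finally show ?thesis .
qed

text \<open>Here position \<open>1\<close> lies in no block, but every value belongs to a pair.\<close>

lemma sum_signed_weight_even_eq_0:
  fixes x :: "nat \<Rightarrow> 'a::{idom, ring_char_0}"
  assumes "n \<ge> 1" "even n"
  shows "(\<Sum>\<sigma> | \<sigma> permutes {1..n}. signed_weight n ((\<lambda>k. 2 * k) ` {1..(n - 1) div 2}) x \<sigma>) = 0"
proof -
  let ?E = "(\<lambda>k. 2 * k) ` {1..(n - 1) div 2}"
  have "{\<sigma>. \<sigma> permutes {1..n} \<and> (\<forall>j\<in>{1..n div 2}. paired ?E \<sigma> j)} = {}"
    using unpaired_position(1)[of _ n ?E 1] assms by fastforce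
  then show ?thesis by (simp only: sum_signed_weight_eq_sum_paired sum.empty)
qed

section \<open>The odd and even major indices\<close>

text \<open>This brings both generating functions into the form of the signed sums above, with \<open>c i = (i + 1)/2\<close>
  on the odd positions and \<open>c i = i/2\<close> on the even ones.\<close>

lemma power_sum_descents:
  fixes y :: "'a::comm_ring_1"
  assumes "{i \<in> {1..n - 1}. P i} = M"
  shows "(- 1) ^ inversion_number n \<sigma> * y ^ (\<Sum>i \<in> {i \<in> descent_set n \<sigma>. P i}. c i)
       = signed_weight n M (\<lambda>i. y ^ c i) \<sigma>"
proof -
  have "{i \<in> descent_set n \<sigma>. P i} = {i \<in> M. \<sigma> i > \<sigma> (Suc i)}" "finite M"
    using assms by (auto simp: descent_set_def Suc_eq_plus1)
  then show ?thesis
    by (simp add: signed_weight_def power_sum prod.inter_filter)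
qed

theorem corollary3p3:
  fixes n :: nat
  assumes "n \<ge> 1"
  shows "(\<Sum>\<sigma> | \<sigma> permutes {1..n}. (- 1) ^ inversion_number n \<sigma> * q ^ omaj n \<sigma>)
           = fact (n div 2) * (\<Prod>i = 1..n div 2. 1 - q ^ i)
       \<and> (\<Sum>\<sigma> | \<sigma> permutes {1..n}. (- 1) ^ inversion_number n \<sigma> * q ^ emaj n \<sigma>)
           = smult (parity_coeff (int n + 1)) (fact (n div 2) * (\<Prod>i = 1..(n - 1) div 2. 1 - q ^ i))"
proof
  have "{i \<in> {1..n - 1}. odd i} = (\<lambda>k. 2 * k - 1) ` {1..n div 2}"
  proof (intro equalityI subsetI)
    fix i assume "i \<in> {i \<in> {1..n - 1}. odd i}"
    then have "i = 2 * ((i + 1) div 2) - 1" "(i + 1) div 2 \<in> {1..n div 2}"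
      by (auto elim!: oddE)
    then show "i \<in> (\<lambda>k. 2 * k - 1) ` {1..n div 2}" by (rule image_eqI)
  qed auto
  note odd = power_sum_descents[OF this]
  show "(\<Sum>\<sigma> | \<sigma> permutes {1..n}. (- 1) ^ inversion_number n \<sigma> * q ^ omaj n \<sigma>)
           = fact (n div 2) * (\<Prod>i = 1..n div 2. 1 - q ^ i)"
    unfolding omaj_def odd sum_signed_weight_odd by (intro arg_cong2[of _ _ _ _ "(*)"] prod.cong) auto
  have "{i \<in> {1..n - 1}. even i} = (\<lambda>k. 2 * k) ` {1..(n - 1) div 2}"
    by (auto elim!: evenE)
  note even = power_sum_descents[OF this]
  show "(\<Sum>\<sigma> | \<sigma> permutes {1..n}. (- 1) ^ inversion_number n \<sigma> * q ^ emaj n \<sigma>)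
           = smult (parity_coeff (int n + 1)) (fact (n div 2) * (\<Prod>i = 1..(n - 1) div 2. 1 - q ^ i))"
  proof (cases "even n")
    case True
    then have "parity_coeff (int n + 1) = 0" by (simp add: parity_coeff_def power_int_minus_left)
    then show ?thesis
      unfolding emaj_def even sum_signed_weight_even_eq_0[OF assms True] by simp
  next
    case False
    then obtain m where m: "n = 2 * m + 1" by (elim oddE)
    have "parity_coeff (int n + 1) = 1" using False by (simp add: parity_coeff_def power_int_minus_left)
    then show ?thesis
      unfolding emaj_def even using sum_signed_weight_even[OF m, of "\<lambda>i. q ^ (i div 2)"] m by simp
  qed
qed

end
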